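(* Let $X$ and $Y$ be Banach spaces. Then $Z=X\oplus_\infty Y$ has the Ball Huskable Property ($BHP$) if and only if both $X$ and $Y$ have $BHP$.
   Context: Banach spaces $X,Y$ are real and nontrivial; $B_X$ is the closed unit ball of $X$. $X\oplus_\infty Y$ is $X\times Y$ with norm $\|(x,y)\|=\max\{\|x\|,\|y\|\}$. $X$ has $BHP$ if $B_X$ has nonempty relatively weakly open subsets of arbitrarily small diameter (for every $\varepsilon>0$ there is a nonempty relatively weakly open subset of $B_X$ of diameter less than $\varepsilon$). *)

theory Defs
  imports "HOL-Analysis.Analysis"
begin

text \<open>
  The library's product type carries the Euclidean norm, so the product with the maximum norm
  is a separate type.
\<close>

datatype ('a, 'b) linf_sum (infixr \<open>\<oplus>\<^sub>\<infinity>\<close> 20) = LinfPair (lfst: 'a) (lsnd: 'b)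

instantiation linf_sum :: (real_vector, real_vector) real_vector
begin

definition zero_linf_sum :: "'a \<oplus>\<^sub>\<infinity> 'b" where
  "0 = LinfPair 0 0"

definition plus_linf_sum :: "'a \<oplus>\<^sub>\<infinity> 'b \<Rightarrow> 'a \<oplus>\<^sub>\<infinity> 'b \<Rightarrow> 'a \<oplus>\<^sub>\<infinity> 'b" where
  "z + w = LinfPair (lfst z + lfst w) (lsnd z + lsnd w)"

definition uminus_linf_sum :: "'a \<oplus>\<^sub>\<infinity> 'b \<Rightarrow> 'a \<oplus>\<^sub>\<infinity> 'b" where
  "- z = LinfPair (- lfst z) (- lsnd z)"

definition minus_linf_sum :: "'a \<oplus>\<^sub>\<infinity> 'b \<Rightarrow> 'a \<oplus>\<^sub>\<infinity> 'b \<Rightarrow> 'a \<oplus>\<^sub>\<infinity> 'b" where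
  "z - w = LinfPair (lfst z - lfst w) (lsnd z - lsnd w)"

definition scaleR_linf_sum :: "real \<Rightarrow> 'a \<oplus>\<^sub>\<infinity> 'b \<Rightarrow> 'a \<oplus>\<^sub>\<infinity> 'b" where
  "c *\<^sub>R z = LinfPair (c *\<^sub>R lfst z) (c *\<^sub>R lsnd z)"

instance
  by standard
    (simp_all add: zero_linf_sum_def plus_linf_sum_def uminus_linf_sum_def minus_linf_sum_def
      scaleR_linf_sum_def algebra_simps linf_sum.expand)

end

instantiation linf_sum :: (real_normed_vector, real_normed_vector) real_normed_vector
begin

definition norm_linf_sum :: "'a \<oplus>\<^sub>\<infinity> 'b \<Rightarrow> real" where
  "norm_linf_sum z = max (norm (lfst z)) (norm (lsnd z))"

definition dist_linf_sum :: "'a \<oplus>\<^sub>\<infinity> 'b \<Rightarrow> 'a \<oplus>\<^sub>\<infinity> 'b \<Rightarrow> real" where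
  "dist_linf_sum z w = norm (z - w)"

definition sgn_linf_sum :: "'a \<oplus>\<^sub>\<infinity> 'b \<Rightarrow> 'a \<oplus>\<^sub>\<infinity> 'b" where
  "sgn_linf_sum z = inverse (norm z) *\<^sub>R z"

definition uniformity_linf_sum :: "(('a \<oplus>\<^sub>\<infinity> 'b) \<times> ('a \<oplus>\<^sub>\<infinity> 'b)) filter" where
  "uniformity_linf_sum = (INF e\<in>{0 <..}. principal {(z, w). dist z w < e})"

definition open_linf_sum :: "('a \<oplus>\<^sub>\<infinity> 'b) set \<Rightarrow> bool" where
  "open_linf_sum U \<longleftrightarrow> (\<forall>z\<in>U. \<forall>\<^sub>F (z', w) in uniformity. z' = z \<longrightarrow> w \<in> U)"

instance
proof
  fix z w :: "'a \<oplus>\<^sub>\<infinity> 'b" and c :: real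
  show "norm z = 0 \<longleftrightarrow> z = 0"
  proof
    assume "norm z = 0"
    then have "norm (lfst z) \<le> 0" "norm (lsnd z) \<le> 0"
      unfolding norm_linf_sum_def by linarith+
    then show "z = 0"
      by (simp add: zero_linf_sum_def linf_sum.expand)
  qed (simp add: norm_linf_sum_def zero_linf_sum_def)
  show "norm (z + w) \<le> norm z + norm w"
    using norm_triangle_ineq[of "lfst z" "lfst w"] norm_triangle_ineq[of "lsnd z" "lsnd w"]
    unfolding norm_linf_sum_def plus_linf_sum_def linf_sum.sel by linarith
  show "norm (c *\<^sub>R z) = \<bar>c\<bar> * norm z"
    by (simp add: norm_linf_sum_def scaleR_linf_sum_def max_mult_distrib_left)
qed (simp_all only: dist_linf_sum_def sgn_linf_sum_def uniformity_linf_sum_def open_linf_sum_def)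

end

instance linf_sum :: (banach, banach) banach
proof
  fix Z :: "nat \<Rightarrow> 'a \<oplus>\<^sub>\<infinity> 'b"
  assume "Cauchy Z"
  have "dist (lfst z) (lfst w) \<le> dist z w" "dist (lsnd z) (lsnd w) \<le> dist z w"
    for z w :: "'a \<oplus>\<^sub>\<infinity> 'b"
    by (simp_all add: dist_norm norm_linf_sum_def minus_linf_sum_def)
  then have "Cauchy (\<lambda>n. lfst (Z n))" "Cauchy (\<lambda>n. lsnd (Z n))"
    using \<open>Cauchy Z\<close> unfolding Cauchy_def by (meson le_less_trans)+
  then obtain x y where xy: "(\<lambda>n. lfst (Z n)) \<longlonglongrightarrow> x" "(\<lambda>n. lsnd (Z n)) \<longlonglongrightarrow> y"
    by (meson Cauchy_convergent_iff convergent_def)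
  have "(\<lambda>n. max (norm (lfst (Z n) - x)) (norm (lsnd (Z n) - y))) \<longlonglongrightarrow> max (norm (x - x)) (norm (y - y))"
    by (intro tendsto_intros xy)
  then have "(\<lambda>n. norm (Z n - LinfPair x y)) \<longlonglongrightarrow> 0"
    by (simp add: norm_linf_sum_def minus_linf_sum_def)
  then have "Z \<longlonglongrightarrow> LinfPair x y"
    by (simp add: tendsto_norm_zero_iff LIM_zero_iff)
  then show "convergent Z"
    by (auto simp: convergent_def)
qed

definition weak_topology :: "'a::real_normed_vector topology" where
  "weak_topology =
    topology_generated_by {f -` U | (f :: 'a \<Rightarrow> real) U. bounded_linear f \<and> open U}"

text \<open>
  The library's \<^const>\<open>diameter\<close> is the supremum of distances only for nonempty bounded sets; the
  sets below are nonempty subsets of the unit ball.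
\<close>

definition BHP :: "'a::real_normed_vector itself \<Rightarrow> bool" where
  "BHP _ \<longleftrightarrow>
    (\<forall>\<epsilon>>0. \<exists>W. openin (subtopology weak_topology (cball (0::'a) 1)) W \<and> W \<noteq> {} \<and> diameter W < \<epsilon>)"

end

theory Submission
  imports Defs
begin

text \<open>
  The unit ball of \<open>X \<oplus>\<^sub>\<infinity> Y\<close> is the product of the unit balls of \<open>X\<close> and \<open>Y\<close>. This is what makes
  both directions direct: maps between the spaces that are bounded linear up to a translation are
  weakly continuous (\<open>continuous_map_weak_affine\<close>), and the ones below carry balls to balls, so
  preimages of relatively weakly open subsets of the target ball are relatively weakly open
  subsets of the source ball.

  If \<open>X \<oplus>\<^sub>\<infinity> Y\<close> has \<open>BHP\<close>, let \<open>W\<close> be a small relatively weakly open subset of its ball and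
  \<open>(x, y) \<in> W\<close>. The section \<open>{u \<in> B\<^sub>X. (u, y) \<in> W}\<close> is the preimage of \<open>W\<close> under the isometric
  embedding \<open>u \<mapsto> (u, y)\<close>, which maps \<open>B\<^sub>X\<close> into the unit ball of the sum because
  \<open>\<parallel>y\<parallel> \<le> 1\<close>. So it is relatively weakly open, it contains \<open>x\<close>, and its diameter is at most that
  of \<open>W\<close>. The same holds for \<open>Y\<close>; \<open>BHP_pullback\<close> treats both factors.

  Conversely, if \<open>U\<close> and \<open>V\<close> are small relatively weakly open subsets of \<open>B\<^sub>X\<close> and \<open>B\<^sub>Y\<close>, then
  \<open>U \<times> V\<close> is the intersection of their preimages under the two projections, and its diameter is at
  most the larger of the two diameters.
\<close>

lemma topspace_weak_topology [simp]:
  "topspace (weak_topology :: 'a::real_normed_vector topology) = UNIV"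
proof -
  have "(UNIV :: 'a set) = (\<lambda>_. 0::real) -` UNIV"
    by simp
  then have "(UNIV :: 'a set) \<in> {f -` U | (f :: 'a \<Rightarrow> real) U. bounded_linear f \<and> open U}"
    using bounded_linear_zero by blast
  then show ?thesis
    unfolding weak_topology_def topology_generated_by_topspace by blast
qed

lemma openin_weak_topology_vimage:
  fixes f :: "'a::real_normed_vector \<Rightarrow> real"
  assumes "bounded_linear f" "open U"
  shows "openin weak_topology (f -` U)"
  unfolding weak_topology_def using assms by (auto intro: topology_generated_by_Basis)

text \<open>
  A functional composed with \<open>x \<mapsto> L x + c\<close> is a functional plus a constant, and the constant only
  translates the open set of reals that defines a subbasic weakly open set.
\<close>

lemma continuous_map_weak_affine:
  fixes L :: "'a::real_normed_vector \<Rightarrow> 'b::real_normed_vector"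
  assumes L: "bounded_linear L"
  shows "continuous_map weak_topology weak_topology (\<lambda>x. L x + c)"
  unfolding weak_topology_def[where 'a='b]
proof (rule continuous_on_generated_topo)
  fix S assume "S \<in> {f -` U | (f :: 'b \<Rightarrow> real) U. bounded_linear f \<and> open U}"
  then obtain f :: "'b \<Rightarrow> real" and U where f: "bounded_linear f" and U: "open U" and S: "S = f -` U"
    by blast
  have "(\<lambda>x. L x + c) -` S = (\<lambda>x. f (L x)) -` ((\<lambda>t. t + f c) -` U)"
    by (auto simp: S linear_add[OF bounded_linear.linear[OF f]])
  moreover have "open ((\<lambda>t. t + f c) -` U)"
    by (intro open_vimage U continuous_intros)
  ultimately show "openin weak_topology
      ((\<lambda>x. L x + c) -` S \<inter> topspace (weak_topology :: 'a topology))"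
    using openin_weak_topology_vimage[OF bounded_linear_compose[OF f L]] by simp
next
  have "\<Union> {f -` U | (f :: 'b \<Rightarrow> real) U. bounded_linear f \<and> open U} = UNIV"
    using topspace_weak_topology[where 'a='b]
    unfolding weak_topology_def topology_generated_by_topspace .
  then show "(\<lambda>x. L x + c) ` topspace (weak_topology :: 'a topology)
      \<subseteq> \<Union> {f -` U | (f :: 'b \<Rightarrow> real) U. bounded_linear f \<and> open U}"
    by simp
qed

lemma openin_weak_unit_ball_vimage:
  fixes L :: "'a::real_normed_vector \<Rightarrow> 'b::real_normed_vector"
  assumes L: "bounded_linear L"
    and ball: "\<And>x. norm x \<le> 1 \<Longrightarrow> norm (L x + c) \<le> 1"
    and W: "openin (subtopology weak_topology (cball 0 1)) W"
  shows "openin (subtopology weak_topology (cball 0 1)) {x \<in> cball 0 1. L x + c \<in> W}"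
proof -
  have "continuous_map (subtopology weak_topology (cball 0 1))
      (subtopology weak_topology (cball 0 1)) (\<lambda>x. L x + c)"
    using ball
    by (auto simp: continuous_map_in_subtopology
        intro: continuous_map_from_subtopology continuous_map_weak_affine L)
  from openin_continuous_map_preimage[OF this W] show ?thesis
    by simp
qed

lemma openin_unit_ball_norm_le:
  assumes "openin (subtopology weak_topology (cball 0 1)) W" "w \<in> W"
  shows "norm w \<le> 1"
  using openin_subset[OF assms(1)] assms(2) by auto

text \<open>
  A supremum over an unbounded set of reals has no meaningful value, so it is the boundedness of the
  ball that makes \<^const>\<open>diameter\<close> an upper bound for the distances.
\<close>

lemma dist_le_diameter_openin_unit_ball:
  assumes "openin (subtopology weak_topology (cball 0 1)) W" "u \<in> W" "v \<in> W"
  shows "dist u v \<le> diameter W"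
proof -
  have "W \<subseteq> cball 0 1"
    using openin_unit_ball_norm_le[OF assms(1)] by auto
  then show ?thesis
    using assms(2,3) bounded_subset[OF bounded_cball] diameter_bounded_bound by blast
qed

text \<open>
  The translation is allowed to depend on the point \<open>w\<close>, since the section of a small set has to be
  taken through one of its own points.
\<close>

lemma BHP_pullback:
  fixes L :: "'a::real_normed_vector \<Rightarrow> 'b::real_normed_vector"
  assumes "BHP TYPE('b)"
    and L: "bounded_linear L" and iso: "\<And>x. norm (L x) = norm x"
    and lift: "\<And>w. norm w \<le> 1 \<Longrightarrow>
      \<exists>c x. norm x \<le> 1 \<and> L x + c = w \<and> (\<forall>u. norm u \<le> 1 \<longrightarrow> norm (L u + c) \<le> 1)"
  shows "BHP TYPE('a)"
  unfolding BHP_def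
proof (intro allI impI)
  fix \<epsilon> :: real assume "\<epsilon> > 0"
  then obtain W :: "'b set"
    where W: "openin (subtopology weak_topology (cball 0 1)) W" "W \<noteq> {}" "diameter W < \<epsilon>"
    using assms(1) unfolding BHP_def by blast
  then obtain w where "w \<in> W"
    by blast
  then obtain c x where x: "norm x \<le> 1" "L x + c = w"
      and ball: "\<And>u. norm u \<le> 1 \<Longrightarrow> norm (L u + c) \<le> 1"
    using lift openin_unit_ball_norm_le[OF W(1)] by meson
  define V where "V = {u \<in> cball 0 1. L u + c \<in> W}"
  have "openin (subtopology weak_topology (cball 0 1)) V"
    unfolding V_def by (rule openin_weak_unit_ball_vimage[OF L ball W(1)])
  moreover have "x \<in> V"
    using x \<open>w \<in> W\<close> by (simp add: V_def)
  moreover have "diameter V \<le> diameter W"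
  proof (rule diameter_le)
    show "V \<noteq> {} \<or> 0 \<le> diameter W"
      using \<open>x \<in> V\<close> by blast
    fix u v assume "u \<in> V" "v \<in> V"
    then have "dist (L u + c) (L v + c) \<le> diameter W"
      unfolding V_def by (blast intro: dist_le_diameter_openin_unit_ball[OF W(1)])
    moreover have "dist (L u + c) (L v + c) = norm (u - v)"
      using iso[of "u - v"] by (simp add: dist_norm linear_diff[OF bounded_linear.linear[OF L]])
    ultimately show "norm (u - v) \<le> diameter W"
      by simp
  qed
  ultimately show "\<exists>V. openin (subtopology weak_topology (cball (0::'a) 1)) V \<and> V \<noteq> {}
      \<and> diameter V < \<epsilon>"
    using W(3) by (intro exI[of _ V]) auto
qed

lemma bounded_linear_lfst:
  "bounded_linear (lfst :: ('a::real_normed_vector \<oplus>\<^sub>\<infinity> 'b::real_normed_vector) \<Rightarrow> 'a)"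
  by (rule bounded_linear_intro[where K = 1])
    (simp_all add: plus_linf_sum_def scaleR_linf_sum_def norm_linf_sum_def)

lemma bounded_linear_lsnd:
  "bounded_linear (lsnd :: ('a::real_normed_vector \<oplus>\<^sub>\<infinity> 'b::real_normed_vector) \<Rightarrow> 'b)"
  by (rule bounded_linear_intro[where K = 1])
    (simp_all add: plus_linf_sum_def scaleR_linf_sum_def norm_linf_sum_def)

lemma bounded_linear_LinfPair_left:
  "bounded_linear (\<lambda>x. LinfPair x 0 :: 'a::real_normed_vector \<oplus>\<^sub>\<infinity> 'b::real_normed_vector)"
  by (rule bounded_linear_intro[where K = 1])
    (simp_all add: plus_linf_sum_def scaleR_linf_sum_def norm_linf_sum_def)

lemma bounded_linear_LinfPair_right:
  "bounded_linear (\<lambda>y. LinfPair 0 y :: 'a::real_normed_vector \<oplus>\<^sub>\<infinity> 'b::real_normed_vector)"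
  by (rule bounded_linear_intro[where K = 1])
    (simp_all add: plus_linf_sum_def scaleR_linf_sum_def norm_linf_sum_def)

lemma BHP_linf_sum_left:
  assumes "BHP TYPE('a::real_normed_vector \<oplus>\<^sub>\<infinity> 'b::real_normed_vector)"
  shows "BHP TYPE('a)"
proof (rule BHP_pullback[OF assms bounded_linear_LinfPair_left])
  fix w :: "'a \<oplus>\<^sub>\<infinity> 'b" assume "norm w \<le> 1"
  then show "\<exists>c x. norm x \<le> 1 \<and> LinfPair x 0 + c = w
      \<and> (\<forall>u. norm u \<le> 1 \<longrightarrow> norm (LinfPair u 0 + c) \<le> 1)"
    by (intro exI[of _ "LinfPair 0 (lsnd w)"] exI[of _ "lfst w"])
      (simp add: norm_linf_sum_def plus_linf_sum_def)
qed (simp add: norm_linf_sum_def)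

lemma BHP_linf_sum_right:
  assumes "BHP TYPE('a::real_normed_vector \<oplus>\<^sub>\<infinity> 'b::real_normed_vector)"
  shows "BHP TYPE('b)"
proof (rule BHP_pullback[OF assms bounded_linear_LinfPair_right])
  fix w :: "'a \<oplus>\<^sub>\<infinity> 'b" assume "norm w \<le> 1"
  then show "\<exists>c y. norm y \<le> 1 \<and> LinfPair 0 y + c = w
      \<and> (\<forall>u. norm u \<le> 1 \<longrightarrow> norm (LinfPair 0 u + c) \<le> 1)"
    by (intro exI[of _ "LinfPair (lfst w) 0"] exI[of _ "lsnd w"])
      (simp add: norm_linf_sum_def plus_linf_sum_def)
qed (simp add: norm_linf_sum_def)

lemma BHP_linf_sum:
  assumes "BHP TYPE('a::real_normed_vector)" "BHP TYPE('b::real_normed_vector)"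
  shows "BHP TYPE('a \<oplus>\<^sub>\<infinity> 'b)"
  unfolding BHP_def
proof (intro allI impI)
  fix \<epsilon> :: real assume "\<epsilon> > 0"
  then obtain U :: "'a set" and V :: "'b set"
    where U: "openin (subtopology weak_topology (cball 0 1)) U" "U \<noteq> {}" "diameter U < \<epsilon>"
      and V: "openin (subtopology weak_topology (cball 0 1)) V" "V \<noteq> {}" "diameter V < \<epsilon>"
    using assms unfolding BHP_def by meson
  define W :: "('a \<oplus>\<^sub>\<infinity> 'b) set"
    where "W = {z \<in> cball 0 1. lfst z \<in> U} \<inter> {z \<in> cball 0 1. lsnd z \<in> V}"
  have "openin (subtopology weak_topology (cball 0 1)) {z :: 'a \<oplus>\<^sub>\<infinity> 'b. z \<in> cball 0 1 \<and> lfst z \<in> U}"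
    by (rule openin_weak_unit_ball_vimage[OF bounded_linear_lfst _ U(1), of 0, unfolded add_0_right])
      (simp add: norm_linf_sum_def)
  moreover have "openin (subtopology weak_topology (cball 0 1))
      {z :: 'a \<oplus>\<^sub>\<infinity> 'b. z \<in> cball 0 1 \<and> lsnd z \<in> V}"
    by (rule openin_weak_unit_ball_vimage[OF bounded_linear_lsnd _ V(1), of 0, unfolded add_0_right])
      (simp add: norm_linf_sum_def)
  ultimately have "openin (subtopology weak_topology (cball 0 1)) W"
    unfolding W_def by (rule openin_Int)
  moreover obtain x y where xy: "x \<in> U" "y \<in> V"
    using U(2) V(2) by blast
  then have "LinfPair x y \<in> W"
    using openin_unit_ball_norm_le[OF U(1)] openin_unit_ball_norm_le[OF V(1)]
    by (simp add: W_def norm_linf_sum_def)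
  moreover have "diameter W \<le> max (diameter U) (diameter V)"
  proof (rule diameter_le)
    show "W \<noteq> {} \<or> 0 \<le> max (diameter U) (diameter V)"
      using \<open>LinfPair x y \<in> W\<close> by blast
    fix z w assume "z \<in> W" "w \<in> W"
    then have "dist (lfst z) (lfst w) \<le> diameter U" "dist (lsnd z) (lsnd w) \<le> diameter V"
      unfolding W_def
      by (blast intro: dist_le_diameter_openin_unit_ball[OF U(1)]
          dist_le_diameter_openin_unit_ball[OF V(1)])+
    then show "norm (z - w) \<le> max (diameter U) (diameter V)"
      by (auto simp: norm_linf_sum_def minus_linf_sum_def dist_norm)
  qed
  ultimately show "\<exists>W. openin (subtopology weak_topology (cball (0 :: 'a \<oplus>\<^sub>\<infinity> 'b) 1)) W \<and> W \<noteq> {}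
      \<and> diameter W < \<epsilon>"
    using U(3) V(3) by (intro exI[of _ W]) auto
qed

theorem proposition2p11:
  assumes "\<exists>x::'a::banach. x \<noteq> 0" and "\<exists>y::'b::banach. y \<noteq> 0"
  shows "BHP TYPE('a \<oplus>\<^sub>\<infinity> 'b) \<longleftrightarrow> BHP TYPE('a) \<and> BHP TYPE('b)"
  using BHP_linf_sum BHP_linf_sum_left BHP_linf_sum_right by blast

end
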